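(* Let $N\in\mathbb{N}$, $N\geq 1$, let $r_1>r_2>\dots>r_N>0$, and put $t^i_j=(r_j/r_i)^3$ for $i,j=1,\dots,N$. For a scalar $\lambda$, let $P_N(\lambda)$ be the $N\times N$ matrix with diagonal entries $\lambda_j$, where $\lambda_j=\lambda$ if $j$ is odd and $\lambda_j=1-\lambda$ if $j$ is even, with entries $(P_N(\lambda))_{ij}=-1$ for $i<j$ and $(P_N(\lambda))_{ij}=2(r_i/r_j)^3$ for $i>j$. Define $q(\lambda)=\lambda^2-\lambda$. Then the determinant $|P_N(\lambda)|$ satisfies $$|P_N(\lambda)|=(-1)^L\sum_{k=0}^L 2^k q(\lambda)^{L-k}\Big(\sum_{\mathbf{i}_{2k}\in C_{N}^{0,2k}}\tau_{\mathbf{i}_{2k}}\prod_{l=1}^k t^{i_{2l-1}}_{i_{2l}}\Big)\quad\text{if } N=2L,$$ and $$|P_N(\lambda)|=\lambda\,(-1)^L\sum_{k=0}^L 2^k q(\lambda)^{L-k}\Big(\sum_{\mathbf{i}_{2k}\in C_{N}^{0,2k}}\tau_{\mathbf{i}_{2k}}\prod_{l=1}^k t^{i_{2l-1}}_{i_{2l}}\Big)\quad\text{if } N=2L+1.$$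
   Context: $C_N^{0,m}$ denotes the set of all combinations of $m$ elements out of $\{1,\dots,N\}$, each written as a multi-index $\mathbf{i}_m=(i_1,\dots,i_m)$ in increasing order, $1\le i_1<i_2<\dots<i_m\le N$. The sign of a multi-index is $\tau_{\mathbf{i}_m}=(-1)^{i_1+i_2+\dots+i_m}$. For $m=0$ the only combination is the empty one, so the inner sum for $k=0$ equals $1$. *)

theory Defs
  imports Complex_Main "Jordan_Normal_Form.Determinant"
begin

definition tt :: "(nat \<Rightarrow> real) \<Rightarrow> nat \<Rightarrow> nat \<Rightarrow> real" where
  "tt r i j = (r j / r i) ^ 3"

(* A multi-index (i_1, ..., i_m) is the list [i_1, ..., i_m]; list positions start at 0,
   so i_l is the list entry at position l - 1. *)
definition combs :: "nat \<Rightarrow> nat \<Rightarrow> nat list set" where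
  "combs N m = {I. length I = m \<and> sorted_wrt (<) I \<and> set I \<subseteq> {1..N}}"

lemma finite_combs: "finite (combs N m)"
  by (rule finite_subset[OF _ finite_lists_length_eq[of "{1..N}" m]]) (auto simp: combs_def)

lemma combs_0: "combs N 0 = {[]}"
  by (auto simp: combs_def)

definition sign_of :: "nat list \<Rightarrow> real" where
  "sign_of I = (- 1) ^ sum_list I"

(* The factor for l is t with upper index i_(2l-1) and lower index i_(2l). *)
definition comb_sum :: "nat \<Rightarrow> (nat \<Rightarrow> real) \<Rightarrow> nat \<Rightarrow> real" where
  "comb_sum N r k =
     (\<Sum>I\<in>combs N (2 * k). sign_of I * (\<Prod>l=1..k. tt r (I ! (2 * l - 2)) (I ! (2 * l - 1))))"

definition P_entry :: "(nat \<Rightarrow> real) \<Rightarrow> 'a::real_field \<Rightarrow> nat \<Rightarrow> nat \<Rightarrow> 'a" where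
  "P_entry r lam i j =
     (if i = j then (if odd j then lam else 1 - lam)
      else if i < j then - 1
      else of_real (2 * (r i / r j) ^ 3))"

(* Rows and columns of mat are numbered from 0, hence the shift. *)
definition P_mat :: "nat \<Rightarrow> (nat \<Rightarrow> real) \<Rightarrow> 'a::real_field \<Rightarrow> 'a mat" where
  "P_mat N r lam = mat N N (\<lambda>(i, j). P_entry r lam (i + 1) (j + 1))"

definition q :: "'a::real_field \<Rightarrow> 'a" where
  "q lam = lam\<^sup>2 - lam"

end

theory Submission
  imports Defs
begin

text \<open>
  Both sides satisfy the same three-term recurrence in \<open>N\<close>. Write \<open>x\<^sub>i = r\<^sub>i\<^sup>3\<close> and
  \<open>s = x\<^sub>N\<^sub>+\<^sub>2 / x\<^sub>N\<^sub>+\<^sub>1\<close>.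

  The matrix is built from rank-one triangles: to the left of the diagonal, each row is a multiple
  of the row above it, and above the diagonal, each column repeats its left neighbour. Subtracting
  \<open>s\<close> times row \<open>N + 1\<close> from row \<open>N + 2\<close>, and then column \<open>N + 1\<close> from column \<open>N + 2\<close>, therefore
  leaves only the last two entries in the last row and in the last column. Laplace expansion then
  expresses the determinant by the two preceding ones (\<open>det_P_mat_rec\<close>). If \<open>d\<close> is the diagonal
  entry number \<open>N + 1\<close>, the coefficients are \<open>(1 - s) (1 - d)\<close> and \<open>s (2 - d) (1 + d)\<close>; the second
  one is \<open>s (2 - q \<lambda>)\<close> for either parity because \<open>q \<lambda> = q (1 - \<lambda>)\<close>.

  For the sums over combinations, one asks whether the largest index \<open>N + 1\<close> occurs. Removing it
  from a combination of even size leaves one of odd size whose last index still waits for a partner;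
  eliminating these odd sums from two consecutive steps gives, for the sums \<open>S(N, k)\<close>,
  \<open>S(N + 2, k + 1) = (1 - s) S(N + 1, k + 1) + s (S(N, k + 1) - S(N, k))\<close> (\<open>comb_sum_rec\<close>).
  Weighted with \<open>2\<^sup>k q\<^sup>L\<^sup>-\<^sup>k\<close>, the term \<open>S(N, k + 1)\<close> contributes the factor \<open>q\<close> and the term
  \<open>S(N, k)\<close> the factor \<open>2\<close>, which together make up \<open>2 - q\<close> after the sign \<open>(-1)\<^sup>L\<close> is taken into
  account. When \<open>N\<close> is odd, the factor \<open>1 - d = \<lambda>\<close> is the one in front of the formula for odd size.
  When \<open>N\<close> is even, \<open>1 - d = 1 - \<lambda>\<close> meets the \<open>\<lambda>\<close> of the preceding odd size, and
  \<open>\<lambda> (1 - \<lambda>) = - q \<lambda>\<close> yields the additional power of \<open>q\<close>.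
\<close>

section \<open>A three-term recurrence for the determinant\<close>

text \<open>
  Expansion along the last column leaves two minors: a leading one, and one whose last row has a
  single nonzero entry, so that one more expansion reaches the next smaller leading minor. This is
  the same step as in the recurrence for continuants.
\<close>

lemma det_last_row_column_sparse:
  fixes f :: "nat \<Rightarrow> nat \<Rightarrow> 'a::comm_ring_1"
  assumes row: "\<And>j. j < n \<Longrightarrow> f (Suc n) j = 0"
    and col: "\<And>i. i < n \<Longrightarrow> f i (Suc n) = 0"
  defines "D \<equiv> \<lambda>m. det (mat m m (\<lambda>(i, j). f i j))"
  shows "D (Suc (Suc n)) = f (Suc n) (Suc n) * D (Suc n) - f n (Suc n) * f (Suc n) n * D n"
proof -
  let ?A = "mat (Suc (Suc n)) (Suc (Suc n)) (\<lambda>(i, j). f i j)"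
  let ?B = "mat_delete ?A n (Suc n)"
  have corner: "mat_delete ?A (Suc n) (Suc n) = mat (Suc n) (Suc n) (\<lambda>(i, j). f i j)"
    by (rule eq_matI) (auto simp: mat_delete_def)
  have corner2: "mat_delete ?B n n = mat n n (\<lambda>(i, j). f i j)"
    by (rule eq_matI) (auto simp: mat_delete_def)
  have "det ?B = (\<Sum>j<Suc n. ?B $$ (n, j) * cofactor ?B n j)"
    by (rule laplace_expansion_row) (auto simp: mat_delete_def)
  also have "\<dots> = f (Suc n) n * D n"
    by (simp add: cofactor_def corner2 D_def) (simp add: mat_delete_def row)
  finally have B: "det ?B = f (Suc n) n * D n" .
  have "det ?A = (\<Sum>i<Suc (Suc n). ?A $$ (i, Suc n) * cofactor ?A i (Suc n))"
    by (rule laplace_expansion_column) auto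
  also have "\<dots> = f n (Suc n) * cofactor ?A n (Suc n) + f (Suc n) (Suc n) * cofactor ?A (Suc n) (Suc n)"
    by (simp add: col)
  also have "\<dots> = f (Suc n) (Suc n) * D (Suc n) - f n (Suc n) * f (Suc n) n * D n"
    by (simp add: cofactor_def B corner D_def)
  finally show ?thesis by (simp add: D_def)
qed

text \<open>
  One row operation and one column operation clear the last row and column up to their last two
  entries, and neither operation changes a smaller leading minor.
\<close>

lemma det_proportional_tails:
  fixes f :: "nat \<Rightarrow> nat \<Rightarrow> 'a::comm_ring_1"
  assumes row: "\<And>j. j < n \<Longrightarrow> f (Suc n) j = s * f n j"
    and col: "\<And>i. i < n \<Longrightarrow> f i (Suc n) = f i n"
  defines "D \<equiv> \<lambda>m. det (mat m m (\<lambda>(i, j). f i j))"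
  shows "D (Suc (Suc n)) =
      (f (Suc n) (Suc n) - f (Suc n) n - s * f n (Suc n) + s * f n n) * D (Suc n)
      - (f n (Suc n) - f n n) * (f (Suc n) n - s * f n n) * D n"
proof -
  let ?A = "mat (Suc (Suc n)) (Suc (Suc n)) (\<lambda>(i, j). f i j)"
  \<comment> \<open>\<open>g\<close> and \<open>h\<close> are the entries after the row operation and after the column operation.\<close>
  define g where "g i j = (if i = Suc n then f i j - s * f n j else f i j)" for i j
  define h where "h i j = (if j = Suc n then g i j - g i n else g i j)" for i j
  have ops: "addcol (- 1) (Suc n) n (addrow (- s) (Suc n) n ?A)
      = mat (Suc (Suc n)) (Suc (Suc n)) (\<lambda>(i, j). h i j)"
    by (rule eq_matI) (auto simp: h_def g_def)
  have "det (mat (Suc (Suc n)) (Suc (Suc n)) (\<lambda>(i, j). h i j))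
      = det (addrow (- s) (Suc n) n ?A)"
    unfolding ops[symmetric] by (rule det_addcol[where n = "Suc (Suc n)"]) auto
  also have "\<dots> = det ?A"
    by (rule det_addrow[where n = "Suc (Suc n)"]) auto
  finally have "D (Suc (Suc n)) = det (mat (Suc (Suc n)) (Suc (Suc n)) (\<lambda>(i, j). h i j))"
    by (simp add: D_def)
  also have "\<dots> = h (Suc n) (Suc n) * det (mat (Suc n) (Suc n) (\<lambda>(i, j). h i j))
      - h n (Suc n) * h (Suc n) n * det (mat n n (\<lambda>(i, j). h i j))"
    by (rule det_last_row_column_sparse) (auto simp: h_def g_def row col)
  also have "mat (Suc n) (Suc n) (\<lambda>(i, j). h i j) = mat (Suc n) (Suc n) (\<lambda>(i, j). f i j)"
    by (rule eq_matI) (auto simp: h_def g_def)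
  also have "mat n n (\<lambda>(i, j). h i j) = mat n n (\<lambda>(i, j). f i j)"
    by (rule eq_matI) (auto simp: h_def g_def)
  finally show ?thesis
    by (simp add: D_def h_def g_def algebra_simps)
qed

lemma det_P_mat_rec:
  fixes lam :: "'a::real_field"
  assumes "r (Suc n) \<noteq> 0"
  defines "s \<equiv> of_real (tt r (Suc n) (Suc (Suc n))) :: 'a"
  shows "det (P_mat (Suc (Suc n)) r lam) =
      (1 - s) * (if odd n then lam else 1 - lam) * det (P_mat (Suc n) r lam)
      + s * (2 - q lam) * det (P_mat n r lam)"
proof -
  define f where "f i j = P_entry r lam (Suc i) (Suc j)" for i j
  define d where "d = (if odd n then 1 - lam else lam)"
  have P: "P_mat m r lam = mat m m (\<lambda>(i, j). f i j)" for m
    by (simp add: P_mat_def f_def)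
  have row: "f (Suc n) j = s * f n j" if "j < n" for j
    using that assms(1) by (simp add: f_def s_def P_entry_def tt_def power_divide)
  have col: "f i (Suc n) = f i n" if "i < n" for i
    using that by (simp add: f_def P_entry_def)
  have entries: "f (Suc n) (Suc n) = 1 - d" "f (Suc n) n = 2 * s" "f n (Suc n) = - 1" "f n n = d"
    by (simp_all add: f_def P_entry_def d_def s_def tt_def)
  \<comment> \<open>The parity of the diagonal entry disappears here, as \<open>d\<^sup>2 - d\<close> is invariant under \<open>d \<mapsto> 1 - d\<close>.\<close>
  have q: "(2 - d) * (1 + d) = 2 - q lam"
    by (simp add: d_def q_def power2_eq_square algebra_simps)
  have "det (P_mat (Suc (Suc n)) r lam) =
      (f (Suc n) (Suc n) - f (Suc n) n - s * f n (Suc n) + s * f n n) * det (P_mat (Suc n) r lam)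
      - (f n (Suc n) - f n n) * (f (Suc n) n - s * f n n) * det (P_mat n r lam)"
    unfolding P by (rule det_proportional_tails[OF row col])
  also have "\<dots> = (1 - s) * (1 - d) * det (P_mat (Suc n) r lam)
      + s * ((2 - d) * (1 + d)) * det (P_mat n r lam)"
    unfolding entries by (simp add: algebra_simps)
  finally show ?thesis by (simp add: q) (simp add: d_def)
qed

section \<open>The same recurrence for the sums over combinations\<close>

lemma combs_Suc_Suc:
  "combs (Suc N) (Suc m) = combs N (Suc m) \<union> (\<lambda>I. I @ [Suc N]) ` combs N m" (is "?L = ?R")
proof
  show "?R \<subseteq> ?L"
    by (auto simp: combs_def sorted_wrt_append subset_iff less_Suc_eq_le)
  show "?L \<subseteq> ?R"
  proof
    fix I assume I: "I \<in> ?L"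
    then have "I \<noteq> []" by (auto simp: combs_def)
    then obtain J a where Ja: "I = J @ [a]" by (metis rev_exhaust)
    have J: "length J = m" "sorted_wrt (<) J" "\<And>x. x \<in> set J \<Longrightarrow> 1 \<le> x \<and> x < a"
      and a: "1 \<le> a" "a \<le> Suc N"
      using I by (auto simp: combs_def Ja sorted_wrt_append)
    show "I \<in> ?R"
    proof (cases "a = Suc N")
      case True
      with J have "J \<in> combs N m" by (force simp: combs_def)
      with True Ja show ?thesis by auto
    next
      case False
      with J a have "I \<in> combs N (Suc m)"
        by (force simp: combs_def Ja sorted_wrt_append)
      then show ?thesis by simp
    qed
  qed
qed

lemma sum_combs_Suc_Suc:
  "sum f (combs (Suc N) (Suc m)) = sum f (combs N (Suc m)) + (\<Sum>I\<in>combs N m. f (I @ [Suc N]))"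
proof -
  have "combs N (Suc m) \<inter> (\<lambda>I. I @ [Suc N]) ` combs N m = {}"
    by (auto simp: combs_def)
  moreover have "inj_on (\<lambda>I. I @ [Suc N]) (combs N m)"
    by (auto intro: inj_onI)
  ultimately show ?thesis
    by (simp add: combs_Suc_Suc sum.union_disjoint finite_combs sum.reindex)
qed

text \<open>
  The sums for combinations of odd size \<open>2 k + 1\<close>. The last index has no partner yet and
  contributes only the denominator of its future factor \<open>t\<close>; appending a further index \<open>i\<close> supplies
  the numerator \<open>r\<^sub>i\<^sup>3\<close>.
\<close>

definition odd_comb_sum :: "nat \<Rightarrow> (nat \<Rightarrow> real) \<Rightarrow> nat \<Rightarrow> real" where
  "odd_comb_sum N r k =
     (\<Sum>I\<in>combs N (2 * k + 1). sign_of I *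
        (\<Prod>l=1..k. tt r (I ! (2 * l - 2)) (I ! (2 * l - 1))) / r (I ! (2 * k)) ^ 3)"

lemma prod_tt_append:
  assumes "2 * k \<le> length I"
  shows "(\<Prod>l=1..k. tt r ((I @ [a]) ! (2 * l - 2)) ((I @ [a]) ! (2 * l - 1)))
       = (\<Prod>l=1..k. tt r (I ! (2 * l - 2)) (I ! (2 * l - 1)))"
  using assms by (intro prod.cong) (auto simp: nth_append)

text \<open>
  The added term collects the combinations that contain \<open>Suc N\<close>. There \<open>Suc N\<close> comes last and is the
  second index of the last pair.
\<close>

lemma comb_sum_Suc_Suc:
  "comb_sum (Suc N) r (Suc k) =
     comb_sum N r (Suc k) + (- 1) ^ Suc N * r (Suc N) ^ 3 * odd_comb_sum N r k"
proof -
  have "(\<Sum>I\<in>combs N (Suc (2 * k)). sign_of (I @ [Suc N]) * (\<Prod>l=1..Suc k.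
            tt r ((I @ [Suc N]) ! (2 * l - 2)) ((I @ [Suc N]) ! (2 * l - 1))))
      = (\<Sum>I\<in>combs N (2 * k + 1). (- 1) ^ Suc N * r (Suc N) ^ 3 * (sign_of I *
        (\<Prod>l=1..k. tt r (I ! (2 * l - 2)) (I ! (2 * l - 1))) / r (I ! (2 * k)) ^ 3))"
  proof (rule sum.cong)
    fix I assume "I \<in> combs N (2 * k + 1)"
    then have len: "length I = Suc (2 * k)" by (simp add: combs_def)
    have last: "tt r ((I @ [Suc N]) ! (2 * Suc k - 2)) ((I @ [Suc N]) ! (2 * Suc k - 1))
        = r (Suc N) ^ 3 / r (I ! (2 * k)) ^ 3"
      by (simp add: nth_append len tt_def power_divide)
    have sign: "sign_of (I @ [Suc N]) = sign_of I * (- 1) ^ Suc N"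
      unfolding sign_of_def by (simp only: sum_list_append power_add) simp
    have prod: "(\<Prod>l=1..Suc k. tt r ((I @ [Suc N]) ! (2 * l - 2)) ((I @ [Suc N]) ! (2 * l - 1)))
        = (\<Prod>l=1..k. tt r (I ! (2 * l - 2)) (I ! (2 * l - 1))) * (r (Suc N) ^ 3 / r (I ! (2 * k)) ^ 3)"
      using prod_tt_append[of k I r "Suc N"] last len by (simp only: prod.cl_ivl_Suc) simp
    show "sign_of (I @ [Suc N]) * (\<Prod>l=1..Suc k.
            tt r ((I @ [Suc N]) ! (2 * l - 2)) ((I @ [Suc N]) ! (2 * l - 1)))
      = (- 1) ^ Suc N * r (Suc N) ^ 3 * (sign_of I *
        (\<Prod>l=1..k. tt r (I ! (2 * l - 2)) (I ! (2 * l - 1))) / r (I ! (2 * k)) ^ 3)"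
      unfolding sign prod by (simp only: times_divide_eq_right times_divide_eq_left ac_simps)
  qed simp
  then show ?thesis
    using sum_combs_Suc_Suc[of "\<lambda>I. sign_of I * (\<Prod>l=1..Suc k. tt r (I ! (2 * l - 2)) (I ! (2 * l - 1)))"
        N "Suc (2 * k)"]
    by (simp only: comb_sum_def odd_comb_sum_def sum_distrib_left mult_Suc_right add_2_eq_Suc)
qed

text \<open>
  In a combination of odd size, \<open>Suc N\<close> can only be the index without a partner, and the indices
  before it form complete pairs.
\<close>

lemma odd_comb_sum_Suc:
  "odd_comb_sum (Suc N) r k =
     odd_comb_sum N r k + (- 1) ^ Suc N / r (Suc N) ^ 3 * comb_sum N r k"
proof -
  have "(\<Sum>I\<in>combs N (2 * k). sign_of (I @ [Suc N]) *
            (\<Prod>l=1..k. tt r ((I @ [Suc N]) ! (2 * l - 2)) ((I @ [Suc N]) ! (2 * l - 1)))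
            / r ((I @ [Suc N]) ! (2 * k)) ^ 3)
      = (\<Sum>I\<in>combs N (2 * k). (- 1) ^ Suc N / r (Suc N) ^ 3 *
          (sign_of I * (\<Prod>l=1..k. tt r (I ! (2 * l - 2)) (I ! (2 * l - 1)))))"
  proof (rule sum.cong)
    fix I assume "I \<in> combs N (2 * k)"
    then have len: "length I = 2 * k" by (simp add: combs_def)
    have sign: "sign_of (I @ [Suc N]) = sign_of I * (- 1) ^ Suc N"
      unfolding sign_of_def by (simp only: sum_list_append power_add) simp
    have last: "(I @ [Suc N]) ! (2 * k) = Suc N"
      by (simp add: nth_append len)
    show "sign_of (I @ [Suc N]) *
            (\<Prod>l=1..k. tt r ((I @ [Suc N]) ! (2 * l - 2)) ((I @ [Suc N]) ! (2 * l - 1)))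
            / r ((I @ [Suc N]) ! (2 * k)) ^ 3
      = (- 1) ^ Suc N / r (Suc N) ^ 3 *
          (sign_of I * (\<Prod>l=1..k. tt r (I ! (2 * l - 2)) (I ! (2 * l - 1))))"
      unfolding sign last prod_tt_append[OF eq_imp_le[OF len[symmetric]]]
      by (simp only: times_divide_eq_right times_divide_eq_left ac_simps)
  qed simp
  then show ?thesis
    using sum_combs_Suc_Suc[of "\<lambda>I. sign_of I *
        (\<Prod>l=1..k. tt r (I ! (2 * l - 2)) (I ! (2 * l - 1))) / r (I ! (2 * k)) ^ 3" N "2 * k"]
    by (simp only: comb_sum_def odd_comb_sum_def sum_distrib_left Suc_eq_plus1[symmetric])
qed

text \<open>
  By the two preceding lemmas, \<open>comb_sum\<close> and \<open>odd_comb_sum\<close> form a first-order linear system in \<open>N\<close>.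
  Eliminating \<open>odd_comb_sum\<close> turns it into a second-order recurrence for \<open>comb_sum\<close> alone.
\<close>

lemma comb_sum_rec:
  assumes "r (Suc N) \<noteq> 0"
  defines "s \<equiv> tt r (Suc N) (Suc (Suc N))"
  shows "comb_sum (Suc (Suc N)) r (Suc k) =
      (1 - s) * comb_sum (Suc N) r (Suc k) + s * (comb_sum N r (Suc k) - comb_sum N r k)"
proof -
  define x where "x = r (Suc N) ^ 3"
  define y where "y = r (Suc (Suc N)) ^ 3"
  define e :: real where "e = (- 1) ^ N"
  have x: "x \<noteq> 0" and s: "s = y / x" and e: "e * e = 1"
    using assms by (auto simp: x_def y_def e_def tt_def power_divide power_mult_distrib[symmetric])
  have 1: "comb_sum (Suc (Suc N)) r (Suc k)
      = comb_sum (Suc N) r (Suc k) + e * y * odd_comb_sum (Suc N) r k"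
    by (simp add: comb_sum_Suc_Suc[of "Suc N"] e_def y_def)
  have 2: "comb_sum (Suc N) r (Suc k) = comb_sum N r (Suc k) - e * x * odd_comb_sum N r k"
    by (simp add: comb_sum_Suc_Suc[of "N"] e_def x_def)
  have 3: "odd_comb_sum (Suc N) r k = odd_comb_sum N r k - e / x * comb_sum N r k"
    by (simp add: odd_comb_sum_Suc e_def x_def)
  have "e * y * odd_comb_sum (Suc N) r k
      = s * (e * x * odd_comb_sum N r k) - e * e * s * comb_sum N r k"
    unfolding 3 s using x by (simp add: field_simps)
  also have "e * x * odd_comb_sum N r k = comb_sum N r (Suc k) - comb_sum (Suc N) r (Suc k)"
    using 2 by simp
  finally show ?thesis
    unfolding 1 e by (simp add: algebra_simps)
qed

lemma comb_sum_0: "comb_sum N r 0 = 1"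
  by (simp add: comb_sum_def combs_0 sign_of_def)

lemma comb_sum_eq_0:
  assumes "N < 2 * k"
  shows "comb_sum N r k = 0"
proof -
  have "combs N (2 * k) = {}"
  proof (rule ccontr)
    assume "combs N (2 * k) \<noteq> {}"
    then obtain I where I: "length I = 2 * k" "sorted_wrt (<) I" "set I \<subseteq> {1..N}"
      by (auto simp: combs_def)
    then have "card (set I) = 2 * k"
      by (metis distinct_card strict_sorted_iff)
    with card_mono[OF _ I(3)] assms show False by simp
  qed
  then show ?thesis by (simp add: comb_sum_def)
qed

section \<open>Comparison of the two recurrences\<close>

text \<open>
  The polynomial with coefficients \<open>c\<close>, homogeneous of degree \<open>L\<close> in the two quantities \<open>2\<close> and
  \<open>z\<close>. Homogeneity makes the shifts of \<open>k\<close> in the recurrence into multiplications by \<open>2\<close> or \<open>z\<close>.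
\<close>

definition hom_sum :: "'a::real_field \<Rightarrow> nat \<Rightarrow> (nat \<Rightarrow> real) \<Rightarrow> 'a" where
  "hom_sum z L c = (\<Sum>k=0..L. 2 ^ k * z ^ (L - k) * of_real (c k))"

lemma hom_sum_Suc_top:
  "hom_sum z (Suc L) c = z * hom_sum z L c + 2 ^ Suc L * of_real (c (Suc L))"
  by (auto simp: hom_sum_def sum_distrib_left Suc_diff_le intro!: sum.cong)

lemma hom_sum_Suc_bot:
  "hom_sum z (Suc L) c = z ^ Suc L * of_real (c 0) + 2 * hom_sum z L (\<lambda>k. c (Suc k))"
  unfolding hom_sum_def by (subst sum.atLeast0_atMost_Suc_shift) (simp add: sum_distrib_left ac_simps)

lemma hom_sum_lin:
  "hom_sum z L (\<lambda>k. a * f k + b * (g k - h k))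
     = of_real a * hom_sum z L f + of_real b * (hom_sum z L g - hom_sum z L h)"
  by (simp add: hom_sum_def sum_distrib_left sum.distrib[symmetric] sum_subtractf[symmetric] algebra_simps)

text \<open>
  The term with \<open>k = 0\<close> is not covered by \<open>comb_sum_rec\<close>; it fits since all sums for \<open>k = 0\<close> are \<open>1\<close>
  and the coefficients \<open>1 - s\<close> and \<open>s\<close> add up to \<open>1\<close>.
\<close>

lemma hom_sum_comb_sum_rec:
  fixes z :: "'a::real_field"
  assumes "r (Suc N) \<noteq> 0"
  defines "s \<equiv> of_real (tt r (Suc N) (Suc (Suc N))) :: 'a"
  shows "hom_sum z (Suc L) (comb_sum (Suc (Suc N)) r) =
      (1 - s) * hom_sum z (Suc L) (comb_sum (Suc N) r)
      + s * (hom_sum z (Suc L) (comb_sum N r) - 2 * hom_sum z L (comb_sum N r))"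
  unfolding hom_sum_Suc_bot comb_sum_rec[of r N, OF assms(1)] hom_sum_lin comb_sum_0 s_def
  by (simp add: algebra_simps)

lemma hom_sum_comb_sum_Suc:
  assumes "N < 2 * Suc L"
  shows "hom_sum z (Suc L) (comb_sum N r) = z * hom_sum z L (comb_sum N r)"
  using assms by (simp add: hom_sum_Suc_top comb_sum_eq_0)

text \<open>
  Both parities are treated in one formula because the recurrence passes from one to the other. Size
  \<open>0\<close> is included, where the determinant is \<open>1\<close>, so that the induction can start from sizes \<open>0\<close>
  and \<open>1\<close>.
\<close>

lemma det_P_mat_hom_sum:
  fixes lam :: "'a::real_field"
  assumes "\<And>i. 1 \<le> i \<Longrightarrow> i < N \<Longrightarrow> r i \<noteq> 0"
  shows "det (P_mat N r lam) = (if odd N then lam else 1) * (- 1) ^ (N div 2)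
      * hom_sum (q lam) (N div 2) (comb_sum N r)"
  using assms
proof (induction N rule: induct_nat_012)
  case 0
  then show ?case by (simp add: P_mat_def hom_sum_def comb_sum_0)
next
  case 1
  then show ?case by (simp add: P_mat_def P_entry_def hom_sum_def comb_sum_0 det_single)
next
  case (ge2 n)
  define s :: 'a where "s = of_real (tt r (Suc n) (Suc (Suc n)))"
  define L where "L = n div 2"
  define z where "z = q lam"
  define H where "H m k = hom_sum z m (comb_sum k r)" for m k
  have r: "r (Suc n) \<noteq> 0" by (rule ge2.prems) auto
  have n: "det (P_mat n r lam) = (if odd n then lam else 1) * (- 1) ^ L * H L n"
    and Sn: "det (P_mat (Suc n) r lam) = (if even n then lam else 1) * (- 1) ^ (Suc n div 2) * H (Suc n div 2) (Suc n)"
    using ge2.IH ge2.prems by (auto simp: L_def H_def z_def)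
  have D: "det (P_mat (Suc (Suc n)) r lam) =
      (1 - s) * (if odd n then lam else 1 - lam) * det (P_mat (Suc n) r lam)
      + s * (2 - z) * det (P_mat n r lam)"
    unfolding s_def z_def using r by (rule det_P_mat_rec)
  have H: "H (Suc L) (Suc (Suc n)) =
      (1 - s) * H (Suc L) (Suc n) + s * (H (Suc L) n - 2 * H L n)"
    unfolding H_def s_def using r by (rule hom_sum_comb_sum_rec)
  have Hn: "H (Suc L) n = z * H L n"
    unfolding H_def by (rule hom_sum_comb_sum_Suc) (auto simp: L_def)
  have z: "z = lam * lam - lam" by (simp add: z_def q_def power2_eq_square)
  have L: "Suc (Suc n) div 2 = Suc L" by (simp add: L_def)
  show ?case
  proof (cases "even n")
    case True
    then have "Suc n div 2 = L" by (auto simp: L_def)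
    moreover have "H (Suc L) (Suc n) = z * H L (Suc n)"
      unfolding H_def using True by (intro hom_sum_comb_sum_Suc) (auto simp: L_def elim!: evenE)
    ultimately show ?thesis
      using True unfolding D n Sn L H_def[symmetric] z_def[symmetric] H Hn
      by simp (simp add: z algebra_simps)
  next
    case False
    then have "Suc n div 2 = Suc L" by (auto simp: L_def elim!: oddE)
    then show ?thesis
      using False unfolding D n Sn L H_def[symmetric] z_def[symmetric] H Hn
      by simp (simp add: algebra_simps)
  qed
qed

theorem theorem2p2:
  fixes N L :: nat and r :: "nat \<Rightarrow> real" and lam :: "'a::real_field"
  assumes "N \<ge> 1"
    and "\<And>i j. 1 \<le> i \<Longrightarrow> i < j \<Longrightarrow> j \<le> N \<Longrightarrow> r i > r j"
    and "\<And>i. 1 \<le> i \<Longrightarrow> i \<le> N \<Longrightarrow> r i > 0"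
  shows "(N = 2 * L \<longrightarrow>
            det (P_mat N r lam) =
              (- 1) ^ L * (\<Sum>k=0..L. 2 ^ k * q lam ^ (L - k) * of_real (comb_sum N r k)))
       \<and> (N = 2 * L + 1 \<longrightarrow>
            det (P_mat N r lam) =
              lam * (- 1) ^ L * (\<Sum>k=0..L. 2 ^ k * q lam ^ (L - k) * of_real (comb_sum N r k)))"
proof -
  have "r i \<noteq> 0" if "1 \<le> i" "i < N" for i
    using assms(3)[of i] that by simp
  from det_P_mat_hom_sum[of N r lam, OF this] show ?thesis
    by (auto simp: hom_sum_def)
qed

end
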